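(* For every integer $n \ge 1$ and every $A \subset \{0,1\}^n$, $$\mathbb{E}\, h_A^{0.53} \;\ge\; 8\,\mu(A)\,(1-\mu(A))\left[\Big(1-\frac{2\sqrt{2}}{3}\Big)\mu(A) + \frac{\sqrt{2}}{3} - \frac14\right].$$
   Context: The hypercube $\{0,1\}^n$ is regarded as a graph in which two vertices are adjacent iff they differ in exactly one coordinate. $\mu$ is the uniform probability measure on $\{0,1\}^n$ and $\mathbb{E}$ is expectation with respect to $\mu$. For $A \subset \{0,1\}^n$, $h_A:\{0,1\}^n \to \mathbb{R}$ is defined by $h_A(x)=0$ if $x \notin A$, and, if $x \in A$, $h_A(x)$ is the number of neighbours of $x$ lying in $A^c = \{0,1\}^n\setminus A$. *)

theory Defs
  imports "HOL-Analysis.Analysis"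
begin

(* Points of {0,1}^n are Boolean lists of length n; the coordinates of x are x ! i for i < n. *)
definition hypercube :: "nat \<Rightarrow> bool list set" where
  "hypercube n = {x. length x = n}"

definition cube_adj :: "nat \<Rightarrow> bool list \<Rightarrow> bool list \<Rightarrow> bool" where
  "cube_adj n x y \<longleftrightarrow>
     x \<in> hypercube n \<and> y \<in> hypercube n \<and> card {i. i < n \<and> x ! i \<noteq> y ! i} = 1"

definition cube_measure :: "nat \<Rightarrow> bool list measure" where
  "cube_measure n = uniform_count_measure (hypercube n)"

definition h_fun :: "nat \<Rightarrow> bool list set \<Rightarrow> bool list \<Rightarrow> real" where
  "h_fun n A x = (if x \<in> A then real (card {y \<in> hypercube n - A. cube_adj n x y}) else 0)"

end

theory Submission
  imports Defs
begin

text \<open>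
  Write \<open>B\<close> for the cubic on the right-hand side, \<open>\<beta> = 0.53\<close> and \<open>\<kappa> = 2 powr \<beta> - 1\<close>.
  The proof is by induction on \<open>n\<close>. Cut \<open>A\<close> by its first coordinate into slices \<open>X\<close>, \<open>Y\<close> of measures
  \<open>x \<ge> y\<close>; each point of \<open>X - Y\<close> gains one boundary edge. Put \<open>a = B x\<close>, \<open>d = x - y\<close>. The reverse
  Minkowski inequality for the exponent \<open>\<beta> < 1\<close> bounds the contribution of \<open>X\<close> below by
  \<open>(a powr (1/\<beta>) + d powr (1/\<beta>)) powr \<beta>\<close>; since \<open>h\<close> is integer valued, so does \<open>d + \<kappa> * a\<close>.
  It remains to see that the larger of the two is at least \<open>2 * B ((x + y) / 2) - B y\<close>.
  As \<open>B\<close> is a cubic, this is \<open>a + K * d\<^sup>2\<close> exactly, where \<open>-4 * K\<close> is the second derivative of \<open>B\<close>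
  at the midpoint. The two lower bounds agree at \<open>d = a\<close>: the first one is used for \<open>d \<le> a\<close>, the
  second one for \<open>d \<ge> a\<close>, where the difference is concave in \<open>d\<close> and only \<open>d = a\<close> and \<open>d = x\<close>
  need checking. The critical estimate is \<open>K * a \<le> \<kappa>\<close> at \<open>d = a\<close>, which holds with a margin
  of about \<open>10\<close> to the power \<open>-4\<close>.
\<close>

section \<open>Lower bounds for \<open>(h + e) powr \<beta>\<close> with
  \<open>\<beta> < 1\<close>\<close>

text \<open>Dual form of the reverse Minkowski inequality: equality for \<open>w = h / (h + e)\<close>, and linear in
  \<open>h powr \<beta>\<close> and \<open>e powr \<beta>\<close>, so that it can be summed with a common \<open>w\<close>.\<close>
lemma powr_add_ge_weighted:
  fixes \<beta> w h e :: real
  assumes \<beta>: "0 < \<beta>" "\<beta> < 1" and w: "0 \<le> w" "w \<le> 1" and h: "0 \<le> h" and e: "0 \<le> e"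
  shows "h powr \<beta> * w powr (1 - \<beta>) + e powr \<beta> * (1 - w) powr (1 - \<beta>) \<le> (h + e) powr \<beta>"
proof (cases "h + e = 0")
  case True
  then have "h = 0" "e = 0" using h e by linarith+
  then show ?thesis by simp
next
  case False
  then have s: "h + e > 0" using h e by linarith
  have young: "a powr \<beta> * b powr (1 - \<beta>) \<le> \<beta> * a + (1 - \<beta>) * b" if "0 \<le> a" "0 \<le> b" for a b :: real
    using Youngs_inequality_0[of \<beta> "1 - \<beta>" a b] that \<beta> by (cases "a = 0 \<or> b = 0") auto
  have eq: "u powr \<beta> * z = (h + e) powr \<beta> * ((u / (h + e)) powr \<beta> * z)" if "0 \<le> u" for u z
    using that s by (simp add: powr_divide)
  have "h powr \<beta> * w powr (1 - \<beta>) + e powr \<beta> * (1 - w) powr (1 - \<beta>)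
      = (h + e) powr \<beta> * ((h / (h + e)) powr \<beta> * w powr (1 - \<beta>)
          + (e / (h + e)) powr \<beta> * (1 - w) powr (1 - \<beta>))"
    unfolding distrib_left by (intro arg_cong2[where f = "(+)"] eq h e)
  also have "\<dots> \<le> (h + e) powr \<beta> * 1"
  proof (rule mult_left_mono)
    have "(h / (h + e)) powr \<beta> * w powr (1 - \<beta>) + (e / (h + e)) powr \<beta> * (1 - w) powr (1 - \<beta>)
        \<le> (\<beta> * (h / (h + e)) + (1 - \<beta>) * w) + (\<beta> * (e / (h + e)) + (1 - \<beta>) * (1 - w))"
      using young[of "h / (h + e)" w] young[of "e / (h + e)" "1 - w"] h e w by simp
    also have "\<dots> = \<beta> * (h / (h + e) + e / (h + e)) + (1 - \<beta>)" by (simp add: algebra_simps)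
    also have "h / (h + e) + e / (h + e) = 1" using s by (simp add: add_divide_distrib[symmetric])
    finally show "(h / (h + e)) powr \<beta> * w powr (1 - \<beta>) + (e / (h + e)) powr \<beta> * (1 - w) powr (1 - \<beta>) \<le> 1"
      by simp
  qed simp
  finally show ?thesis by simp
qed

text \<open>Integrality of \<open>h\<close> enters here: equality holds at \<open>k = 0\<close> and
  \<open>k = 1\<close>, and real arguments strictly between would violate the bound. For
  \<open>k \<ge> 1\<close> the weighted bound with \<open>w = 1/2\<close>, exact at
  \<open>k = 1\<close>, dominates the affine one.\<close>

lemma powr_Suc_ge_affine:
  fixes \<beta> :: real
  assumes \<beta>: "0 < \<beta>" "\<beta> < 1"
  shows "1 + (2 powr \<beta> - 1) * real k powr \<beta> \<le> (real k + 1) powr \<beta>"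
proof (cases "k = 0")
  case False
  define H where "H = real k powr \<beta>"
  have H: "H \<ge> 1" using False \<beta> by (simp add: H_def ge_one_powr_ge_zero)
  have half: "(1/2 :: real) powr (1 - \<beta>) = 2 powr \<beta> / 2"
    by (simp add: powr_diff powr_divide)
  have "H * (1/2) powr (1 - \<beta>) + (1/2) powr (1 - \<beta>) \<le> (real k + 1) powr \<beta>"
    using powr_add_ge_weighted[OF \<beta>, of "1/2" "real k" 1] by (simp add: H_def)
  then have "2 powr \<beta> / 2 * (H + 1) \<le> (real k + 1) powr \<beta>"
    unfolding half by (simp add: field_simps)
  moreover have "0 \<le> (2 - 2 powr \<beta>) * (H - 1)"
    using H powr_mono[of \<beta> 1 2] \<beta> by simp
  ultimately show ?thesis unfolding H_def[symmetric] by (simp add: algebra_simps)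
qed simp

lemma sum_powr_add_indicator_ge_weighted:
  fixes \<beta> w :: real
  assumes \<beta>: "0 < \<beta>" "\<beta> < 1" and w: "0 \<le> w" "w \<le> 1"
    and X: "finite X" "D \<subseteq> X" and h: "\<And>x. x \<in> X \<Longrightarrow> 0 \<le> h x"
  shows "(\<Sum>x\<in>X. h x powr \<beta>) * w powr (1 - \<beta>) + real (card D) * (1 - w) powr (1 - \<beta>)
    \<le> (\<Sum>x\<in>X. (h x + indicator D x) powr \<beta>)"
proof -
  have "real (card D) = (\<Sum>x\<in>X. indicator D x)"
    using X by (simp add: indicator_def sum.If_cases Int_absorb1)
  also have "\<dots> = (\<Sum>x\<in>X. indicator D x powr \<beta>)" 
    by (intro sum.cong) (auto simp: indicator_def)
  finally have "(\<Sum>x\<in>X. h x powr \<beta>) * w powr (1 - \<beta>) + real (card D) * (1 - w) powr (1 - \<beta>)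
    = (\<Sum>x\<in>X. h x powr \<beta> * w powr (1 - \<beta>) + indicator D x powr \<beta> * (1 - w) powr (1 - \<beta>))"
    by (simp add: sum.distrib sum_distrib_right)
  also have "\<dots> \<le> (\<Sum>x\<in>X. (h x + indicator D x) powr \<beta>)"
    by (intro sum_mono powr_add_ge_weighted \<beta> w h) auto
  finally show ?thesis .
qed

lemma sum_powr_add_indicator_ge_affine:
  fixes \<beta> :: real and h :: "'a \<Rightarrow> nat"
  assumes \<beta>: "0 < \<beta>" "\<beta> < 1" and X: "finite X" "D \<subseteq> X"
  shows "real (card D) + (2 powr \<beta> - 1) * (\<Sum>x\<in>X. real (h x) powr \<beta>)
    \<le> (\<Sum>x\<in>X. (real (h x) + indicator D x) powr \<beta>)"
proof -
  have \<kappa>: "2 powr \<beta> - 1 \<le> 1" using powr_mono[of \<beta> 1 2] \<beta> by simp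
  have "real (card D) = (\<Sum>x\<in>X. indicator D x)"
    using X by (simp add: indicator_def sum.If_cases Int_absorb1)
  then have "real (card D) + (2 powr \<beta> - 1) * (\<Sum>x\<in>X. real (h x) powr \<beta>)
    = (\<Sum>x\<in>X. indicator D x + (2 powr \<beta> - 1) * real (h x) powr \<beta>)"
    by (simp add: sum.distrib sum_distrib_left)
  also have "\<dots> \<le> (\<Sum>x\<in>X. (real (h x) + indicator D x) powr \<beta>)"
  proof (rule sum_mono)
    fix x
    show "indicator D x + (2 powr \<beta> - 1) * real (h x) powr \<beta> \<le> (real (h x) + indicator D x) powr \<beta>"
      using powr_Suc_ge_affine[OF \<beta>, of "h x"] mult_right_mono[OF \<kappa>, of "real (h x) powr \<beta>"]
      by (cases "x \<in> D") auto
  qed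
  finally show ?thesis .
qed

section \<open>Estimates for the exponent \<open>53/100\<close>\<close>

text \<open>Five decimals are kept because \<open>curvature_bound\<close> is almost tight against
  \<open>44388/100000\<close>.\<close>

lemma two_powr_53_ge: "(144388/100000) \<le> (2::real) powr (53/100)"
proof -
  have "((144388/100000)::real) ^ 100 \<le> 2 ^ 53"
    by (simp add: divide_simps)
  also have "\<dots> = (2 powr (53/100)) ^ 100"
    by (simp add: powr_power)
  finally show ?thesis by (rule power_mono_iff[THEN iffD1, rotated -1]) simp_all
qed

lemma two_powr_53_le: "(2::real) powr (53/100) \<le> 2"
  using powr_mono[of "(53/100)" 1 "2::real"] by simp

text \<open>A chord bound: adding \<open>(4/100) * u^2\<close> keeps the power concave on the unit
  interval, because \<open>2491/10000 = 53/100 * 47/100\<close> times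
  \<open>2 powr (53/100 - 2)\<close> exceeds \<open>8/100\<close>.\<close>

lemma one_plus_powr_53_ge_quadratic:
  fixes u :: real
  assumes u: "0 \<le> u" "u \<le> 1"
  shows "1 + (2 powr (53/100) - 1) * u + (4/100) * u * (1 - u) \<le> (1 + u) powr (53/100)"
proof -
  let ?f = "\<lambda>u::real. (1 + u) powr (53/100) + (4/100) * u^2"
  have "concave_on {0..1} ?f"
  proof (rule f''_le0_imp_concave)
    fix x :: real assume x: "x \<in> {0..1}"
    show "DERIV ?f x :> (53/100) * (1 + x) powr ((53/100) - 1) + (8/100) * x"
      using x by (auto intro!: derivative_eq_intros)
    show "DERIV (\<lambda>x. (53/100) * (1 + x) powr ((53/100) - 1) + (8/100) * x) x :>
        - (2491/10000) * (1 + x) powr (53/100 - 1 - 1) + (8/100)"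
      using x by (auto intro!: derivative_eq_intros)
    have "(1/3::real) \<le> (2 powr (53/100)) / 2 powr 2" using two_powr_53_ge by simp
    also have "\<dots> = 2 powr ((53/100) - 2)" by (rule powr_diff[symmetric])
    also have "\<dots> \<le> (1 + x) powr ((53/100) - 2)"
      using x by (intro powr_mono2') auto
    finally show "- (2491/10000) * (1 + x) powr (53/100 - 1 - 1) + (8/100) \<le> 0" by simp
  qed simp
  from concave_onD[OF this u(1) u(2), of 0 1] 
  have "(1 - u) + u * (2 powr (53/100) + (4/100)) \<le> (1 + u) powr (53/100) + (4/100) * u^2"
    by simp
  then show ?thesis by (simp add: field_simps power2_eq_square)
qed

text \<open>The quadratic bound is applied at \<open>u = s powr (100/53)\<close>. As
  \<open>100/53 = 2 - 6/53\<close>, \<open>u\<close> is at least \<open>s^2\<close> times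
  \<open>1 + (6/53) * (1 - s)\<close>; the gains add up to
  \<open>4/100 + 44388/100000 * 6/53 > 9/100\<close>.\<close>

lemma one_plus_powr_53_ge_cubic:
  fixes s :: real
  assumes s: "0 < s" "s \<le> 1"
  shows "1 + (2 powr (53/100) - 1) * s^2 + (9/100) * s^2 * (1 - s) \<le> (1 + s powr (100/53)) powr (53/100)"
proof -
  define \<kappa> :: real where "\<kappa> = 2 powr (53/100) - 1"
  define u where "u = s powr (100/53)"
  have \<kappa>: "(44388/100000) \<le> \<kappa>" using two_powr_53_ge by (simp add: \<kappa>_def)
  have us: "u \<le> s" using powr_mono'[of 1 "100/53" s] s by (simp add: u_def)
  have u: "0 \<le> u" "u \<le> 1" using us s by (auto simp: u_def)
  have "1 + (6/53) * (1 - s) \<le> s powr (- 6/53)"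
  proof -
    have "ln s \<le> s - 1" using ln_le_minus_one s by blast
    then have "1 + (6/53) * (1 - s) \<le> 1 + (- 6/53) * ln s" by simp
    also have "\<dots> \<le> exp ((- 6/53) * ln s)" by (rule exp_ge_add_one_self)
    also have "\<dots> = s powr (- 6/53)" using s by (simp add: powr_def)
    finally show ?thesis .
  qed
  then have "s^2 * (1 + (6/53) * (1 - s)) \<le> s^2 * s powr (- 6/53)"
    by (rule mult_left_mono) simp
  also have "\<dots> = u"
    using s by (simp add: u_def powr_add[symmetric] powr_numeral[symmetric] del: powr_numeral)
  finally have ul: "s^2 * (1 + (6/53) * (1 - s)) \<le> u" .
  have "s^2 * 1 \<le> s^2 * (1 + (6/53) * (1 - s))" using s by (intro mult_left_mono) auto
  then have us2: "s^2 \<le> u" using ul by linarith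
  have "s^2 * (1 - s) \<le> u * (1 - u)"
    using us us2 s u by (intro mult_mono) auto
  moreover have "\<kappa> * (s^2 * (1 + (6/53) * (1 - s))) \<le> \<kappa> * u"
    using ul \<kappa> by (intro mult_left_mono) auto
  moreover have "(44388/100000) * (s^2 * (1 - s)) \<le> \<kappa> * (s^2 * (1 - s))"
    using \<kappa> s by (intro mult_right_mono) auto
  moreover have "0 \<le> s^2 * (1 - s)" using s by simp
  moreover have "1 + \<kappa> * u + (4/100) * (u * (1 - u)) \<le> (1 + u) powr (53/100)"
    using one_plus_powr_53_ge_quadratic[OF u] by (simp add: \<kappa>_def)
  moreover have "\<kappa> * (s^2 * (1 + (6/53) * (1 - s))) = \<kappa> * s^2 + (6/53) * (\<kappa> * (s^2 * (1 - s)))"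
    by (simp add: field_simps)
  ultimately have "1 + \<kappa> * s^2 + (9/100) * (s^2 * (1 - s)) \<le> (1 + u) powr (53/100)"
    by linarith
  then show ?thesis by (simp add: \<kappa>_def u_def)
qed

section \<open>The cubic in centred form\<close>

definition profile :: "real \<Rightarrow> real" where
  "profile x = 8 * x * (1 - x) * ((1 - 2 * sqrt 2 / 3) * x + sqrt 2 / 3 - 1 / 4)"

definition skew :: real where "skew = 2 - 4 * sqrt 2 / 3"

lemma skew_bounds: "(11438/100000) \<le> skew" "skew \<le> (114382/1000000)"
proof -
  have "(14142135/10000000) \<le> sqrt (2::real)" by (rule real_le_rsqrt) (simp add: power2_eq_square)
  moreover have "sqrt (2::real) \<le> (14142136/10000000)" by (rule real_le_lsqrt) (simp_all add: power2_eq_square)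
  ultimately show "(11438/100000) \<le> skew" "skew \<le> (114382/1000000)" by (simp_all add: skew_def)
qed

text \<open>In the centred variable \<open>v = 2 * x - 1\<close> the only irrational coefficient is \<open>skew\<close>.\<close>
lemma profile_eq: "profile ((1 + v) / 2) = (1 - v^2) * (1 + skew * v) / 2"
proof -
  define r where "r = sqrt (2::real)"
  show ?thesis
    unfolding profile_def skew_def r_def[symmetric] by (simp add: field_simps power2_eq_square)
qed

lemma profile_midpoint:
  "2 * profile ((x + y) / 2) - profile y = profile x + (1 + 3 * skew * (2 * x - 1) - 3 * skew * (x - y)) * (x - y)^2"
proof -
  define r where "r = sqrt (2::real)"
  show ?thesis
    unfolding profile_def skew_def r_def[symmetric] 
    by (simp add: field_simps power2_eq_square)
qed

section \<open>Polynomial estimates, with \<open>skew\<close> relaxed to a rational interval for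
  \<open>c\<close>\<close>

context
  fixes c v :: real
  assumes c: "(11438/100000) \<le> c" "c \<le> (114382/1000000)" and v: "-1 \<le> v" "v \<le> 1"
begin

lemma cubic_nonneg: "0 \<le> (1 - v^2) * (1 + c * v) / 2"
proof -
  have "\<bar>c * v\<bar> \<le> 1 * 1" unfolding abs_mult using c v by (intro mult_mono) auto
  moreover have "v^2 \<le> 1" using v by (simp add: abs_square_le_1)
  ultimately show ?thesis by simp
qed

text \<open>The line is, up to rounding, the tangent at \<open>v = 0.26\<close>, where \<open>curvature_bound\<close> is almost tight.\<close>
lemma cubic_le_tangent: "(1 - v^2) * (1 + c * v) / 2 \<le> (53582/100000) - (2144/10000) * v"
proof -
  have v2: "v^2 \<le> 1" using v by (simp add: abs_square_le_1)
  have main: "(1 - v^2) * (1 + (114382/1000000) * v) / 2 \<le> (53582/100000) - (2144/10000) * v"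
  proof -
    \<comment> \<open>The double root is the point of tangency; the small coefficients split off
      below are rounding errors.\<close>
    have "0 \<le> (v - (26/100))^2 * ((57191/1000000) * v + (529739/1000000))"
      using v by (intro mult_nonneg_nonneg) auto
    also have "\<dots> = ((53582/100000) - (2144/10000) * v) - (1 - v^2) * (1 + (114382/1000000) * v) / 2
        - ((96436/10000000000) + (71684/10000000000) * v + (32/100000000) * v^2)"
      by (simp add: power2_eq_square power3_eq_cube field_simps)
    finally show ?thesis using v zero_le_power2[of v] by linarith
  qed
  show ?thesis
  proof (cases "0 \<le> v")
    case True
    have "c * v \<le> (114382/1000000) * v" using c True by (intro mult_right_mono) auto
    then have "(1 - v^2) * (1 + c * v) \<le> (1 - v^2) * (1 + (114382/1000000) * v)"
      using v2 by (intro mult_left_mono) auto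
    then show ?thesis by (intro order_trans[OF divide_right_mono main]) auto
  next
    case False
    have "(1 - v^2) * (1 + c * v) \<le> (1 - v^2) * (1 + 0)"
      using c v2 False by (intro mult_left_mono) (auto intro: mult_nonneg_nonpos)
    also have "\<dots> \<le> 1" by simp
    finally show ?thesis using False by simp
  qed
qed

lemma cubic_le: "(1 - v^2) * (1 + c * v) / 2 \<le> (51/100)"
proof -
  have v2: "v^2 \<le> 1" using v by (simp add: abs_square_le_1)
  have "(1 - v^2) * (1 + c * v) \<le> (1 - v^2) * (1 + (12/100) * \<bar>v\<bar>)"
  proof (rule mult_left_mono)
    have "c * v \<le> \<bar>c * v\<bar>" by simp
    also have "\<dots> \<le> (12/100) * \<bar>v\<bar>" unfolding abs_mult using c by (intro mult_right_mono) auto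
    finally show "1 + c * v \<le> 1 + (12/100) * \<bar>v\<bar>" by simp
  qed (use v2 in simp)
  also have "\<dots> \<le> (102/100)"
  proof -
    have "0 \<le> (\<bar>v\<bar> - (6/100))^2 + (12/100) * (\<bar>v\<bar> * v^2) + (164/10000)" by simp
    then show ?thesis by (simp add: power2_eq_square algebra_simps)
  qed
  finally show ?thesis by linarith
qed

text \<open>This is \<open>K * a \<le> \<kappa>\<close> at \<open>d = a\<close>. The left side grows
  when \<open>a\<close> is replaced by the tangent \<open>L\<close>, leaving a quadratic in
  \<open>v\<close> that is affine in \<open>c\<close>, so the two ends of the range of
  \<open>c\<close> suffice.\<close>

lemma curvature_bound:
  assumes a: "a = (1 - v^2) * (1 + c * v) / 2"
  shows "(1 + 3 * c * v) * a - 3 * c * a^2 \<le> (44388/100000)"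
proof -
  define L where "L = (53582/100000) - (2144/10000) * v"
  have aL: "a \<le> L" using cubic_le_tangent by (simp add: a L_def)
  have L: "L \<le> (76/100)" "a \<le> (51/100)" using v cubic_le by (simp_all add: L_def a)
  have cv: "-(115/1000) \<le> c * v"
  proof -
    have "\<bar>c * v\<bar> \<le> (115/1000) * 1" unfolding abs_mult using c v by (intro mult_mono) auto
    then show ?thesis by simp
  qed
  have "c * (L + a) \<le> (115/1000) * (127/100)"
  proof -
    have "c * (L + a) \<le> c * (127/100)" using c L by (intro mult_left_mono) auto
    also have "\<dots> \<le> (115/1000) * (127/100)" using c by (intro mult_right_mono) auto
    finally show ?thesis .
  qed
  then have "0 \<le> (L - a) * (1 + 3 * c * v - 3 * c * (L + a))"
    using cv aL by (intro mult_nonneg_nonneg) auto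
  then have "(1 + 3 * c * v) * a - 3 * c * a^2 \<le> L + c * (3 * L * (v - L))"
    by (simp add: algebra_simps power2_eq_square)
  also have "\<dots> \<le> (44388/100000)"
  proof -
    \<comment> \<open>\<open>2703/10000\<close> is, up to rounding, where the quadratic in
      \<open>v\<close> is largest.\<close>
    have "0 \<le> (v - (2703/10000))^2" by simp
    then have sq: "0 \<le> v * v - (5406/10000) * v + (7306209/100000000)"
      by (simp add: power2_eq_square algebra_simps)
    have lower: "L + (11438/100000) * (3 * L * (v - L)) \<le> (44388/100000)"
      using sq v unfolding L_def by (simp add: field_simps)
    have upper: "L + (114382/1000000) * (3 * L * (v - L)) \<le> (44388/100000)"
      using sq v unfolding L_def by (simp add: field_simps)
    show ?thesis
    proof (cases "0 \<le> 3 * L * (v - L)")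
      case True
      then have "c * (3 * L * (v - L)) \<le> (114382/1000000) * (3 * L * (v - L))"
        using c by (intro mult_right_mono)
      then show ?thesis using upper by linarith
    next
      case False
      then have "c * (3 * L * (v - L)) \<le> (11438/100000) * (3 * L * (v - L))"
        using c by (intro mult_right_mono_neg) auto
      then show ?thesis using lower by linarith
    qed
  qed
  finally show ?thesis .
qed

lemma two_point_large_gap:
  assumes a: "a = (1 - v^2) * (1 + c * v) / 2"
    and \<kappa>: "(44388/100000) \<le> \<kappa>" "\<kappa> \<le> 1" and d: "a \<le> d" "d \<le> (1 + v) / 2"
  shows "a + (1 + 3 * c * v - 3 * c * d) * d^2 \<le> d + \<kappa> * a"
proof -
  define X where "X = (1 + v) / 2"
  \<comment> \<open>Right side minus left side as a function of the gap \<open>t\<close>; the end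
    \<open>X\<close> of its range is the case of an empty smaller slice.\<close>
  define G where "G = (\<lambda>t. t - (1 + 3 * c * v) * t^2 + 3 * c * t^3 - (1 - \<kappa>) * a)"
  have a0: "0 \<le> a" using cubic_nonneg a by simp
  have dX: "d \<le> X" using d by (simp add: X_def)
  have Ga: "0 \<le> G a"
  proof -
    have "0 \<le> a * (\<kappa> - ((1 + 3 * c * v) * a - 3 * c * a^2))"
      using curvature_bound[OF a] \<kappa> a0 by (intro mult_nonneg_nonneg) auto
    then show ?thesis by (simp add: G_def algebra_simps power2_eq_square power3_eq_cube)
  qed
  have cv: "\<bar>c * v\<bar> \<le> (115/1000)"
  proof -
    have "\<bar>c * v\<bar> \<le> (115/1000) * 1" unfolding abs_mult using c v by (intro mult_mono) auto
    then show ?thesis by simp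
  qed
  \<comment> \<open>Both \<open>a\<close> and \<open>G X\<close> contain the factor
    \<open>X * (1 - v)\<close>; the cofactor is affine in \<open>v\<close>.\<close>
  have GX: "0 \<le> G X"
  proof -
    have "(1 - \<kappa>) * (1 + c * v) \<le> (1 - (44388/100000)) * (1 + c * v)"
      using \<kappa> cv by (intro mult_right_mono) auto
    moreover have "(11438/100000) * (1 + v) \<le> c * (1 + v)" using c v by (intro mult_right_mono) auto
    moreover have "c * (1 + v) = c + c * v" by (simp add: distrib_left)
    moreover have "- (115/1000) \<le> c * v" using cv by simp
    ultimately have "(1 - \<kappa>) * (1 + c * v) \<le> 1/2 + (75/100) * (c * (1 + v))"
      using c by argo
    then have "0 \<le> 1/2 + (75/100) * c * (1 + v) - (1 - \<kappa>) * (1 + c * v)"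
      by (simp only: mult.assoc diff_ge_0_iff_ge)
    then have "0 \<le> X * (1 - v) * (1/2 + (75/100) * c * (1 + v) - (1 - \<kappa>) * (1 + c * v))"
      using v by (intro mult_nonneg_nonneg) (auto simp: X_def)
    also have "\<dots> = G X"
      by (simp add: G_def X_def a field_simps power2_eq_square power3_eq_cube)
    finally show ?thesis .
  qed
  have slope: "0 \<le> 1 + 3 * c * v - 3 * c * (a + X + d)"
  proof -
    have "c * (a + X + d) \<le> c * (3 * X)" using c d dX by (intro mult_left_mono) auto
    also have "\<dots> = 3/2 * c + 3/2 * (c * v)" by (simp add: X_def field_simps)
    finally have "3 * (c * (a + X + d)) \<le> 1 + 3 * (c * v)" using c cv by linarith
    then show ?thesis by (simp add: mult.assoc)
  qed
  \<comment> \<open>\<open>G\<close> minus its chord on \<open>[a, X]\<close>, via the second divided difference\<close>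
  have "(X - a) * G d = (X - d) * G a + (d - a) * G X
      + (X - a) * ((d - a) * (X - d) * (1 + 3 * c * v - 3 * c * (a + X + d)))"
    by (simp add: G_def algebra_simps power2_eq_square power3_eq_cube)
  also have "\<dots> \<ge> 0"
    using Ga GX slope d dX by (intro add_nonneg_nonneg mult_nonneg_nonneg) auto
  finally have *: "0 \<le> (X - a) * G d" .
  have "0 \<le> G d"
  proof (cases "X = a")
    case True
    then show ?thesis using Ga d dX by simp
  next
    case False
    then show ?thesis using * d dX by (simp add: zero_le_mult_iff)
  qed
  then show ?thesis by (simp add: G_def algebra_simps power2_eq_square power3_eq_cube)
qed

text \<open>With \<open>d = a * s\<close>, lowering \<open>s\<close> from \<open>1\<close> raises
  \<open>K * a\<close> by \<open>3 * c * a^2 * (1 - s)\<close>. The term with \<open>9/100\<close>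
  pays for this, since \<open>a \<le> 51/100\<close>.\<close>

lemma two_point_small_gap:
  assumes a: "a = (1 - v^2) * (1 + c * v) / 2"
    and \<kappa>: "(44388/100000) \<le> \<kappa>" and s: "0 \<le> s" "s \<le> 1"
  shows "a + (1 + 3 * c * v - 3 * c * (a * s)) * (a * s)^2
    \<le> a * (1 + \<kappa> * s^2 + 9/100 * s^2 * (1 - s))"
proof -
  have a0: "0 \<le> a" using cubic_nonneg a by simp
  have "a^2 \<le> (51/100)^2" using a0 cubic_le by (intro power_mono) (auto simp: a)
  then have "c * a^2 \<le> (114382/1000000) * (51/100)^2" using c by (intro mult_mono) auto
  also have "\<dots> \<le> 3/100" by (simp add: power2_eq_square)
  finally have "0 \<le> 9/100 - 3 * c * a^2" by simp
  then have "0 \<le> (9/100 - 3 * c * a^2) * (1 - s)" using s by simp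
  then have "0 \<le> (\<kappa> - ((1 + 3 * c * v) * a - 3 * c * a^2)) + (9/100 - 3 * c * a^2) * (1 - s)"
    using curvature_bound[OF a] \<kappa> by linarith
  then have "0 \<le> a * s^2 * ((\<kappa> - ((1 + 3 * c * v) * a - 3 * c * a^2)) + (9/100 - 3 * c * a^2) * (1 - s))"
    using a0 by (intro mult_nonneg_nonneg) auto
  then show ?thesis by (simp add: algebra_simps power2_eq_square)
qed

end


section \<open>The two-point inequality behind the induction step\<close>

lemma profile_two_point:
  assumes y: "0 \<le> y" "y \<le> x" and x: "x \<le> 1"
    and affine: "x - y + (2 powr (53/100) - 1) * profile x \<le> T"
    and weighted: "\<And>w. \<lbrakk>0 \<le> w; w \<le> 1\<rbrakk> \<Longrightarrow>
      profile x * w powr (1 - 53/100) + (x - y) * (1 - w) powr (1 - 53/100) \<le> T"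
  shows "2 * profile ((x + y) / 2) \<le> T + profile y"
proof -
  define v a d \<kappa> :: real
    where "v = 2 * x - 1" and "a = profile x" and "d = x - y" and "\<kappa> = 2 powr (53/100) - 1"
  have v: "-1 \<le> v" "v \<le> 1" using x y by (auto simp: v_def)
  have a: "a = (1 - v^2) * (1 + skew * v) / 2"
    using profile_eq[of v] by (simp add: v_def a_def)
  have \<kappa>: "44388/100000 \<le> \<kappa>" "\<kappa> \<le> 1"
    using two_powr_53_ge two_powr_53_le by (simp_all add: \<kappa>_def)
  have "a + (1 + 3 * skew * v - 3 * skew * d) * d^2 \<le> T"
  proof (cases "a \<le> d")
    case True
    then have "a + (1 + 3 * skew * v - 3 * skew * d) * d^2 \<le> d + \<kappa> * a"
      using y by (intro two_point_large_gap[OF skew_bounds v a \<kappa>]) (auto simp: d_def v_def)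
    then show ?thesis using affine by (simp add: d_def a_def \<kappa>_def)
  next
    case False
    then have ad: "0 \<le> d" "d < a" using y by (auto simp: d_def)
    define s where "s = d / a"
    have s: "0 \<le> s" "s \<le> 1" "d = a * s" using ad by (auto simp: s_def)
    have "a * (1 + \<kappa> * s^2 + 9/100 * s^2 * (1 - s)) \<le> T"
    proof (cases "s = 0")
      case True
      then show ?thesis using weighted[of 1] by (simp add: a_def)
    next
      case False
      define z where "z = s powr (100/53)"
      \<comment> \<open>The equality case of the dual inequality, for \<open>h\<close> and
        \<open>e\<close> in the ratio \<open>1 : z\<close>, that is
        \<open>a powr (1/\<beta>)\<close> to \<open>d powr (1/\<beta>)\<close>.\<close>
      define w where "w = 1 / (1 + z)"
      have z: "0 \<le> z" by (simp add: z_def)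
      have w: "0 \<le> w" "w \<le> 1" "1 - w = z / (1 + z)" using z by (auto simp: w_def field_simps)
      have sz: "s * z powr (47/100) = z"
      proof -
        have "s * z powr (47/100) = s powr 1 * s powr (47/53)"
          using s by (simp add: z_def powr_powr)
        also have "\<dots> = z" unfolding powr_add[symmetric] by (simp add: z_def)
        finally show ?thesis .
      qed
      have "a * (1 + \<kappa> * s^2 + 9/100 * s^2 * (1 - s)) \<le> a * (1 + z) powr (53/100)"
        using one_plus_powr_53_ge_cubic[of s] s False ad
        by (intro mult_left_mono) (auto simp: \<kappa>_def z_def)
      also have "(1 + z) powr (53/100) = (1 + z) / (1 + z) powr (47/100)"
        using z powr_diff[of "1 + z" 1 "47/100"] by simp
      also have "a * \<dots> = a * w powr (47/100) + a * (s * z powr (47/100)) / (1 + z) powr (47/100)"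
        unfolding sz using z by (simp add: w_def powr_divide field_simps)
      also have "\<dots> = a * w powr (1 - 53/100) + d * (1 - w) powr (1 - 53/100)"
        using z by (simp add: w(3) s(3) powr_divide)
      also have "\<dots> \<le> T" using weighted[OF w(1,2)] by (simp add: a_def d_def)
      finally show ?thesis .
    qed
    then show ?thesis
      using two_point_small_gap[OF skew_bounds v a \<kappa>(1) s(1,2)] by (simp add: s(3))
  qed
  then show ?thesis
    using profile_midpoint[of x y] by (simp add: v_def a_def d_def)
qed

section \<open>Slicing the cube along the first coordinate\<close>

lemma finite_hypercube [simp]: "finite (hypercube n)"
  using finite_lists_length_eq[of "UNIV :: bool set" n] by (simp add: hypercube_def)

lemma card_hypercube: "card (hypercube n) = 2 ^ n"
  using card_lists_length_eq[of "UNIV :: bool set" n] by (simp add: hypercube_def)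

lemma cube_adj_Cons:
  "cube_adj (Suc n) (b # x) (c # y) \<longleftrightarrow>
    x \<in> hypercube n \<and> y \<in> hypercube n \<and> (if b = c then cube_adj n x y else x = y)"
proof -
  let ?J = "{i. i < n \<and> x ! i \<noteq> y ! i}"
  have "{i. i < Suc n \<and> (b # x) ! i \<noteq> (c # y) ! i} = (if b = c then {} else {0}) \<union> Suc ` ?J"
    by (auto simp: nth_Cons' image_iff gr0_conv_Suc less_Suc_eq_0_disj split: if_splits)
  then have "card {i. i < Suc n \<and> (b # x) ! i \<noteq> (c # y) ! i} = (if b = c then 0 else 1) + card ?J"
    by (simp add: card_image)
  moreover have "card ?J = 0 \<longleftrightarrow> x = y" if "length x = n" "length y = n"
    using that by (auto intro: nth_equalityI)
  ultimately show ?thesis by (auto simp: cube_adj_def hypercube_def)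
qed

definition slice :: "bool \<Rightarrow> bool list set \<Rightarrow> bool list set" where
  "slice b A = {x. b # x \<in> A}"

lemma slice_subset: "A \<subseteq> hypercube (Suc n) \<Longrightarrow> slice b A \<subseteq> hypercube n"
  by (auto simp: slice_def hypercube_def)

lemma sum_over_slices:
  assumes "A \<subseteq> hypercube (Suc n)"
  shows "sum f A = (\<Sum>x\<in>slice b A. f (b # x)) + (\<Sum>x\<in>slice (\<not> b) A. f ((\<not> b) # x))"
proof -
  have fin: "finite (slice c A)" for c
    using slice_subset[OF assms] finite_subset finite_hypercube by blast
  have "A = (#) b ` slice b A \<union> (#) (\<not> b) ` slice (\<not> b) A"
  proof (rule set_eqI)
    fix z
    show "z \<in> A \<longleftrightarrow> z \<in> (#) b ` slice b A \<union> (#) (\<not> b) ` slice (\<not> b) A"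
      using assms by (cases z; cases "hd z = b") (auto simp: slice_def hypercube_def)
  qed
  then have "sum f A = sum f ((#) b ` slice b A \<union> (#) (\<not> b) ` slice (\<not> b) A)" by simp
  also have "\<dots> = sum f ((#) b ` slice b A) + sum f ((#) (\<not> b) ` slice (\<not> b) A)"
    using fin by (intro sum.union_disjoint) auto
  finally show ?thesis by (simp add: sum.reindex)
qed

text \<open>Neighbours of \<open>b # x\<close> either keep \<open>b\<close> and move inside the
  slice, or equal \<open>(\<not> b) # x\<close>, the single edge across the cut.\<close>

lemma h_fun_Cons:
  assumes A: "A \<subseteq> hypercube (Suc n)" and x: "x \<in> slice b A"
  shows "h_fun (Suc n) A (b # x) = h_fun n (slice b A) x + indicator (slice b A - slice (\<not> b) A) x"
proof -
  let ?N = "{y \<in> hypercube n - slice b A. cube_adj n x y}"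
  let ?E = "if x \<in> slice (\<not> b) A then {} else {(\<not> b) # x}"
  have xn: "x \<in> hypercube n" using slice_subset[OF A] x by blast
  have "{y \<in> hypercube (Suc n) - A. cube_adj (Suc n) (b # x) y} = (#) b ` ?N \<union> ?E"
  proof (rule set_eqI)
    fix z
    show "z \<in> {y \<in> hypercube (Suc n) - A. cube_adj (Suc n) (b # x) y} \<longleftrightarrow> z \<in> (#) b ` ?N \<union> ?E"
    proof (cases z)
      case Nil
      then show ?thesis by (auto simp: hypercube_def)
    next
      case (Cons c y)
      have "c = b \<or> c = (\<not> b)" by auto
      then show ?thesis using xn Cons
        by (auto simp: cube_adj_Cons slice_def hypercube_def)
    qed
  qed
  moreover have "card ((#) b ` ?N \<union> ?E) = card ?N + card ?E"
    by (subst card_Un_disjoint) (auto simp: card_image)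
  ultimately show ?thesis
    using x by (simp add: h_fun_def slice_def indicator_def)
qed

section \<open>Induction on the dimension\<close>

lemma profile_le_mean_h_fun:
  assumes "A \<subseteq> hypercube n"
  shows "profile (card A / 2 ^ n) \<le> (\<Sum>x\<in>A. h_fun n A x powr (53/100)) / 2 ^ n"
  using assms
proof (induction n arbitrary: A)
  case 0
  \<comment> \<open>The measure is \<open>0\<close> or \<open>1\<close>, and the cubic vanishes at
    both.\<close>
  then have "A = {} \<or> A = {[]}" by (auto simp: hypercube_def)
  then show ?case by (auto simp: profile_def)
next
  case (Suc n)
  define S where "S = (\<lambda>b. \<Sum>x\<in>slice b A.
    (h_fun n (slice b A) x + indicator (slice b A - slice (\<not> b) A) x) powr (53/100))"
  obtain b where b: "card (slice (\<not> b) A) \<le> card (slice b A)"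
    using linear[of "card (slice True A)" "card (slice False A)"] by (metis (full_types))
  define X Y where "X = slice b A" and "Y = slice (\<not> b) A"
  have XY: "X \<subseteq> hypercube n" "Y \<subseteq> hypercube n"
    using slice_subset[OF Suc.prems] by (auto simp: X_def Y_def)
  then have fin: "finite X" "finite Y" using finite_subset finite_hypercube by blast+
  define x y where "x = card X / 2 ^ n" and "y = card Y / (2 ^ n :: real)"
  have card_le: "card X \<le> 2 ^ n" using card_mono[OF _ XY(1)] by (simp add: card_hypercube)
  have xy: "0 \<le> y" "y \<le> x" "x \<le> 1"
    using b card_le by (auto simp: x_def y_def X_def Y_def divide_right_mono)
  \<comment> \<open>Nested slices are the extremal case, with equality here.\<close>
  have D: "x - y \<le> real (card (X - Y)) / 2 ^ n"
    using diff_card_le_card_Diff[OF fin(2), of X]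
    by (simp add: x_def y_def diff_divide_distrib[symmetric] divide_right_mono)
  define U where "U = (\<Sum>z\<in>X. h_fun n X z powr (53/100))"
  have U: "profile x \<le> U / 2 ^ n" using Suc.IH[OF XY(1)] by (simp add: U_def x_def)
  have SX: "S b = (\<Sum>z\<in>X. (h_fun n X z + indicator (X - Y) z) powr (53/100))"
    by (simp add: S_def X_def Y_def)
  have "2 * profile ((x + y) / 2) \<le> S b / 2 ^ n + profile y"
  proof (rule profile_two_point[OF xy])
    let ?h = "\<lambda>z. card {y \<in> hypercube n - X. cube_adj n z y}"
    have "real (card (X - Y)) + (2 powr (53/100) - 1) * (\<Sum>z\<in>X. real (?h z) powr (53/100))
        \<le> (\<Sum>z\<in>X. (real (?h z) + indicator (X - Y) z) powr (53/100))"
      by (rule sum_powr_add_indicator_ge_affine) (use fin in auto)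
    then have "real (card (X - Y)) + (2 powr (53/100) - 1) * U \<le> S b"
      by (simp add: U_def SX h_fun_def)
    then have "(real (card (X - Y)) + (2 powr (53/100) - 1) * U) / 2 ^ n \<le> S b / 2 ^ n"
      by (rule divide_right_mono) simp
    then have "real (card (X - Y)) / 2 ^ n + (2 powr (53/100) - 1) * (U / 2 ^ n) \<le> S b / 2 ^ n"
      by (simp add: add_divide_distrib)
    moreover have "(2 powr (53/100) - 1) * profile x \<le> (2 powr (53/100) - 1) * (U / 2 ^ n)"
      using U two_powr_53_ge by (intro mult_left_mono) auto
    ultimately show "x - y + (2 powr (53/100) - 1) * profile x \<le> S b / 2 ^ n"
      using D by linarith
  next
    fix w :: real assume w: "0 \<le> w" "w \<le> 1"
    have "U * w powr (1 - 53/100) + real (card (X - Y)) * (1 - w) powr (1 - 53/100) \<le> S b"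
      unfolding U_def SX
      by (rule sum_powr_add_indicator_ge_weighted) (use fin w in \<open>auto simp: h_fun_def\<close>)
    then have "(U * w powr (1 - 53/100) + real (card (X - Y)) * (1 - w) powr (1 - 53/100)) / 2 ^ n
        \<le> S b / 2 ^ n"
      by (rule divide_right_mono) simp
    then have "U / 2 ^ n * w powr (1 - 53/100) + real (card (X - Y)) / 2 ^ n * (1 - w) powr (1 - 53/100)
        \<le> S b / 2 ^ n"
      by (simp add: add_divide_distrib)
    moreover have "profile x * w powr (1 - 53/100) \<le> U / 2 ^ n * w powr (1 - 53/100)"
      using U by (intro mult_right_mono) auto
    moreover have "(x - y) * (1 - w) powr (1 - 53/100)
        \<le> real (card (X - Y)) / 2 ^ n * (1 - w) powr (1 - 53/100)"
      using D by (intro mult_right_mono) auto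
    ultimately show "profile x * w powr (1 - 53/100) + (x - y) * (1 - w) powr (1 - 53/100) \<le> S b / 2 ^ n"
      by linarith
  qed
  also have "profile y \<le> (\<Sum>z\<in>Y. h_fun n Y z powr (53/100)) / 2 ^ n"
    using Suc.IH[OF XY(2)] by (simp add: y_def)
  \<comment> \<open>Boundary edges across the cut that start in the smaller slice are
    discarded.\<close>
  also have "\<dots> \<le> S (\<not> b) / 2 ^ n"
    unfolding S_def Y_def
    by (intro divide_right_mono sum_mono powr_mono2) (auto simp: h_fun_def)
  also have "S b / 2 ^ n + S (\<not> b) / 2 ^ n
      = (\<Sum>x\<in>A. h_fun (Suc n) A x powr (53/100)) / 2 ^ n"
    unfolding sum_over_slices[OF Suc.prems, of _ b] S_def
    by (simp add: h_fun_Cons[OF Suc.prems] add_divide_distrib cong: sum.cong)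
  also have "(x + y) / 2 = card A / 2 ^ Suc n"
    using sum_over_slices[OF Suc.prems, of "\<lambda>_. 1 :: nat" b]
    by (simp add: x_def y_def X_def Y_def add_divide_distrib)
  finally show ?case by simp
qed

theorem theorem1p4:
  fixes n :: nat and A :: "bool list set"
  assumes "n \<ge> 1" and "A \<subseteq> hypercube n"
  shows "(\<integral>x. h_fun n A x powr 0.53 \<partial>cube_measure n) \<ge>
    8 * measure (cube_measure n) A * (1 - measure (cube_measure n) A) *
      ((1 - 2 * sqrt 2 / 3) * measure (cube_measure n) A + sqrt 2 / 3 - 1 / 4)"
proof -
  have mA: "measure (cube_measure n) A = card A / 2 ^ n"
    using assms(2) by (simp add: cube_measure_def measure_uniform_count_measure card_hypercube)
  have "(\<integral>x. h_fun n A x powr (53/100) \<partial>cube_measure n)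
      = (\<Sum>x\<in>hypercube n. h_fun n A x powr (53/100)) / 2 ^ n"
    by (simp add: cube_measure_def uniform_count_measure_def lebesgue_integral_point_measure_finite
        card_hypercube sum_divide_distrib)
  \<comment> \<open>Points outside \<open>A\<close> contribute nothing, as
    \<open>0 powr (53/100) = 0\<close>.\<close>
  also have "(\<Sum>x\<in>hypercube n. h_fun n A x powr (53/100)) = (\<Sum>x\<in>A. h_fun n A x powr (53/100))"
    using assms(2) by (intro sum.mono_neutral_right) (auto simp: h_fun_def)
  finally show ?thesis
    using profile_le_mean_h_fun[OF assms(2)] by (simp add: mA profile_def)
qed

end
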